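(* Let $(\mathcal H_k,\delta_i)_{k,i}$ be a semi-cosimplicial Hilbert space (SCH). If, for some $k\in\mathbb N_0$, the SCH is saturated at level $k-1$, then its $k$-th cohomology group is trivial, i.e. every $k$-cocycle is a $k$-coboundary ($\mathcal H_c^k=\mathcal H_b^k$). Hence a saturated SCH has trivial cohomology (in all degrees $k\ge -1$).
   Context: A semi-cosimplicial Hilbert space (SCH) $(\mathcal H_k,\delta_i)_{k,i}$ is a sequence $(\mathcal H_k)_{k\ge -1}$ of Hilbert spaces together with linear isometries $\delta_i:\mathcal H_{n-1}\to\mathcal H_n$ (for all $n\in\mathbb N_0=\{0,1,2,\dots\}$ and $i=0,\dots,n$; the dependence on $n$ is suppressed) satisfying $\delta_j\delta_i=\delta_i\delta_{j-1}$ for $0\le i<j\le n$ (as maps $\mathcal H_{n-2}\to\mathcal H_n$). The maps $\delta_n:\mathcal H_{n-1}\to\mathcal H_n$ (top index) are regarded as embeddings, giving a tower $\mathcal H_{-1}\subset\mathcal H_0\subset\cdots$, and $\mathcal H_\infty$ is the closure of $\bigcup_{k\ge-1}\mathcal H_k$. The associated partial shifts are the isometries $\alpha_n:\mathcal H_\infty\to\mathcal H_\infty$, $n\in\mathbb N_0$, determined by $\alpha_n|_{\mathcal H_k}=\delta_n:\mathcal H_k\to\mathcal H_{k+1}$ for all $k\ge n-1$. The SCH is saturated at level $m$ if $\mathcal H_m=\mathcal H_\infty^{\alpha_{m+1}}$ (the fixed point space of $\alpha_{m+1}$), and saturated if this holds for all $m\ge-1$. Cohomology: put $\mathcal H^n:=\mathcal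 H_n$ for $n\ge-1$, $\mathcal H^{-2}:=\{0\}$, $\partial^{-2}:=0$, and for $n\ge -1$ let $\partial^n:=\sum_{i=0}^{n+1}(-1)^{n+1-i}\delta_i:\mathcal H^n\to\mathcal H^{n+1}$. This is a cochain complex. $\mathcal H_c^k:=\ker\partial^k\subset\mathcal H^k$ is the space of $k$-cocycles, $\mathcal H_b^k:=\partial^{k-1}(\mathcal H^{k-1})$ the space of $k$-coboundaries, and the $k$-th cohomology group is $\mathcal H_c^k/\mathcal H_b^k$. *)

theory Defs
  imports "HOL-Analysis.Analysis" "HOL-Algebra.Elementary_Groups"
begin

text \<open>
  Scalars. A commutative real normed division algebra with multiplicative norm is the
  field of real or the field of complex numbers, so the class below treats real and complex
  Hilbert spaces uniformly and admits nothing else.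
\<close>

class rc_field = real_normed_field +
  fixes kcnj :: "'a \<Rightarrow> 'a"
  assumes kcnj_add: "kcnj (x + y) = kcnj x + kcnj y"
    and mult_kcnj: "x * kcnj x = (norm x)\<^sup>2 *\<^sub>R 1"

instantiation real :: rc_field
begin
definition kcnj_real :: "real \<Rightarrow> real" where "kcnj_real x = x"
instance by standard (auto simp: kcnj_real_def power2_eq_square)
end

instantiation complex :: rc_field
begin
definition kcnj_complex :: "complex \<Rightarrow> complex" where "kcnj_complex = cnj"
instance
  by standard (simp_all add: kcnj_complex_def complex_norm_square[symmetric] scaleR_conv_of_real)
end

text \<open>
  The norm, the topology and completeness are those of the type; the locale says that
  they come from an inner product, linear in its second argument.
\<close>

locale hilbert_space = vector_space smult
  for smult :: "'k::rc_field \<Rightarrow> 'a::banach \<Rightarrow> 'a" +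
  fixes ip :: "'a \<Rightarrow> 'a \<Rightarrow> 'k"
  assumes smult_of_real: "smult (of_real r) x = r *\<^sub>R x"
    and ip_add_right: "ip x (y + z) = ip x y + ip x z"
    and ip_smult_right: "ip x (smult c y) = c * ip x y"
    and ip_commute: "ip y x = kcnj (ip x y)"
    and ip_self: "ip x x = of_real ((norm x)\<^sup>2)"

definition linear_isometry_on ::
  "('k \<Rightarrow> 'a::real_normed_vector \<Rightarrow> 'a) \<Rightarrow> ('k \<Rightarrow> 'b::real_normed_vector \<Rightarrow> 'b)
    \<Rightarrow> 'a set \<Rightarrow> 'b set \<Rightarrow> ('a \<Rightarrow> 'b) \<Rightarrow> bool" where
  "linear_isometry_on smA smB S T f \<longleftrightarrow>
     f ` S \<subseteq> T \<and>
     (\<forall>x\<in>S. \<forall>y\<in>S. f (x + y) = f x + f y) \<and>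
     (\<forall>c. \<forall>x\<in>S. f (smA c x) = smB c (f x)) \<and>
     (\<forall>x\<in>S. norm (f x) = norm x)"

text \<open>
  The Hilbert spaces \<open>H k\<close>, for integers \<open>k \<ge> -1\<close>, are closed subspaces of one ambient
  Hilbert space. This is no restriction, as any sequence of Hilbert spaces embeds in its
  Hilbert sum; the position of the \<open>H k\<close> relative to each other in the
  ambient space is arbitrary and is never used. The map
  \<open>\<delta> n i\<close> is the coface map from \<open>H (n - 1)\<close> to \<open>H n\<close> with index \<open>i\<close>.
\<close>

locale semi_cosimplicial_hilbert_space = hilbert_space smult ip
  for smult :: "'k::rc_field \<Rightarrow> 'a::banach \<Rightarrow> 'a" and ip :: "'a \<Rightarrow> 'a \<Rightarrow> 'k" +
  fixes H :: "int \<Rightarrow> 'a set" and \<delta> :: "int \<Rightarrow> int \<Rightarrow> 'a \<Rightarrow> 'a"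
  assumes H_subspace: "k \<ge> -1 \<Longrightarrow> subspace (H k)"
    and H_closed: "k \<ge> -1 \<Longrightarrow> closed (H k)"
    and delta_isometry:
      "0 \<le> i \<Longrightarrow> i \<le> n \<Longrightarrow> linear_isometry_on smult smult (H (n - 1)) (H n) (\<delta> n i)"
    and delta_delta:
      "0 \<le> i \<Longrightarrow> i < j \<Longrightarrow> j \<le> n \<Longrightarrow> x \<in> H (n - 2) \<Longrightarrow>
         \<delta> n j (\<delta> (n - 1) i x) = \<delta> n i (\<delta> (n - 1) (j - 1) x)"

text \<open>
  The tower. Regarding the top coface maps \<open>\<delta> n n\<close> as inclusions means to fix isometric
  embeddings \<open>\<iota> k\<close> of the \<open>H k\<close> into one Hilbert space that are compatible with the \<open>\<delta> n n\<close>.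
  The closure of the union of their images is unique up to a unique isometric isomorphism
  compatible with the embeddings.
\<close>

locale hilbert_space_tower =
  semi_cosimplicial_hilbert_space smult ip H \<delta> + target: hilbert_space smult' ip'
  for smult :: "'k::rc_field \<Rightarrow> 'a::banach \<Rightarrow> 'a" and ip :: "'a \<Rightarrow> 'a \<Rightarrow> 'k"
    and H :: "int \<Rightarrow> 'a set" and \<delta> :: "int \<Rightarrow> int \<Rightarrow> 'a \<Rightarrow> 'a"
    and smult' :: "'k \<Rightarrow> 'b::banach \<Rightarrow> 'b" and ip' :: "'b \<Rightarrow> 'b \<Rightarrow> 'k" +
  fixes \<iota> :: "int \<Rightarrow> 'a \<Rightarrow> 'b"
  assumes iota_isometry: "k \<ge> -1 \<Longrightarrow> linear_isometry_on smult smult' (H k) UNIV (\<iota> k)"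
    and iota_top: "n \<ge> 0 \<Longrightarrow> x \<in> H (n - 1) \<Longrightarrow> \<iota> n (\<delta> n n x) = \<iota> (n - 1) x"

definition limit_space :: "(int \<Rightarrow> 'a set) \<Rightarrow> (int \<Rightarrow> 'a \<Rightarrow> 'b::topological_space) \<Rightarrow> 'b set" where
  "limit_space H \<iota> = closure (\<Union>k\<in>{-1..}. \<iota> k ` H k)"

text \<open>The conditions determine \<open>partial_shift\<close> on \<open>limit_space H \<iota>\<close>, where alone it is used.\<close>

definition partial_shift ::
  "(int \<Rightarrow> 'a set) \<Rightarrow> (int \<Rightarrow> int \<Rightarrow> 'a \<Rightarrow> 'a) \<Rightarrow> ('k \<Rightarrow> 'b::real_normed_vector \<Rightarrow> 'b)
    \<Rightarrow> (int \<Rightarrow> 'a \<Rightarrow> 'b) \<Rightarrow> int \<Rightarrow> 'b \<Rightarrow> 'b" where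
  "partial_shift H \<delta> smult' \<iota> n = (SOME \<alpha>.
     linear_isometry_on smult' smult' (limit_space H \<iota>) (limit_space H \<iota>) \<alpha> \<and>
     (\<forall>k\<ge>n - 1. \<forall>x\<in>H k. \<alpha> (\<iota> k x) = \<iota> (k + 1) (\<delta> (k + 1) n x)))"

definition saturated_at ::
  "(int \<Rightarrow> 'a set) \<Rightarrow> (int \<Rightarrow> int \<Rightarrow> 'a \<Rightarrow> 'a) \<Rightarrow> ('k \<Rightarrow> 'b::real_normed_vector \<Rightarrow> 'b)
    \<Rightarrow> (int \<Rightarrow> 'a \<Rightarrow> 'b) \<Rightarrow> int \<Rightarrow> bool" where
  "saturated_at H \<delta> smult' \<iota> m \<longleftrightarrow>
     \<iota> m ` H m = {x \<in> limit_space H \<iota>. partial_shift H \<delta> smult' \<iota> (m + 1) x = x}"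

definition saturated ::
  "(int \<Rightarrow> 'a set) \<Rightarrow> (int \<Rightarrow> int \<Rightarrow> 'a \<Rightarrow> 'a) \<Rightarrow> ('k \<Rightarrow> 'b::real_normed_vector \<Rightarrow> 'b)
    \<Rightarrow> (int \<Rightarrow> 'a \<Rightarrow> 'b) \<Rightarrow> bool" where
  "saturated H \<delta> smult' \<iota> \<longleftrightarrow> (\<forall>m\<ge>-1. saturated_at H \<delta> smult' \<iota> m)"

definition cochains :: "(int \<Rightarrow> 'a::zero set) \<Rightarrow> int \<Rightarrow> 'a set" where
  "cochains H n = (if n \<ge> -1 then H n else {0})"

definition cobdry :: "(int \<Rightarrow> int \<Rightarrow> 'a \<Rightarrow> 'a::real_vector) \<Rightarrow> int \<Rightarrow> 'a \<Rightarrow> 'a" where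
  "cobdry \<delta> n x =
     (if n \<ge> -1 then (\<Sum>i = 0..n + 1. (-1) ^ nat (n + 1 - i) *\<^sub>R \<delta> (n + 1) i x) else 0)"

definition cocycles ::
  "(int \<Rightarrow> 'a::real_vector set) \<Rightarrow> (int \<Rightarrow> int \<Rightarrow> 'a \<Rightarrow> 'a) \<Rightarrow> int \<Rightarrow> 'a set" where
  "cocycles H \<delta> k = {x \<in> cochains H k. cobdry \<delta> k x = 0}"

definition coboundaries ::
  "(int \<Rightarrow> 'a::real_vector set) \<Rightarrow> (int \<Rightarrow> int \<Rightarrow> 'a \<Rightarrow> 'a) \<Rightarrow> int \<Rightarrow> 'a set" where
  "coboundaries H \<delta> k = cobdry \<delta> (k - 1) ` cochains H (k - 1)"

definition additive_group :: "'a::monoid_add set \<Rightarrow> 'a monoid" where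
  "additive_group S = \<lparr>carrier = S, mult = (+), one = 0\<rparr>"

definition cohomology_group ::
  "(int \<Rightarrow> 'a::real_vector set) \<Rightarrow> (int \<Rightarrow> int \<Rightarrow> 'a \<Rightarrow> 'a) \<Rightarrow> int \<Rightarrow> 'a set monoid" where
  "cohomology_group H \<delta> k = additive_group (cocycles H \<delta> k) Mod coboundaries H \<delta> k"

end

theory Submission
  imports Defs
begin

text \<open>
  Let \<open>x\<close> be a \<open>k\<close>-cocycle. Since \<open>x\<close> is fixed by \<open>\<alpha> (k + 1)\<close>, the cocycle equation says that
  \<open>x\<close> is the sum of \<open>(-1) ^ (k - i) *\<^sub>R \<alpha> i v\<close> over \<open>i = 0..k\<close> for \<open>v = x\<close>. The set \<open>C\<close> of all \<open>v\<close>
  in the limit space with this property is closed and convex, and it is invariant under the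
  isometry \<open>\<alpha> k\<close>: apply \<open>\<alpha> (k + 1)\<close> to the equation and use \<open>\<alpha> (k + 1) \<circ> \<alpha> i = \<alpha> i \<circ> \<alpha> k\<close>.
  The unique element of \<open>C\<close> of minimal norm is therefore fixed by \<open>\<alpha> k\<close>, so by saturation it lies
  in \<open>H (k - 1)\<close>, and the defining equation of \<open>C\<close> exhibits \<open>x\<close> as its coboundary.
\<close>

section \<open>Conjugation of scalars, and minimal-norm points of convex sets\<close>

lemma kcnj_scaleR: "kcnj (r *\<^sub>R x) = r *\<^sub>R kcnj (x :: 'k::rc_field)"
proof (cases "x = 0 \<or> r = 0")
  case True
  have "kcnj (0::'k) = 0"
    using kcnj_add[of "0::'k" 0] by simp
  with True show ?thesis
    by auto
next
  case False
  \<comment> \<open>By \<open>mult_kcnj\<close> both products are the squared norm of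
    \<open>r *\<^sub>R x\<close>; the nonzero factor \<open>r *\<^sub>R x\<close> then
    cancels.\<close>
  have "(r *\<^sub>R x) * kcnj (r *\<^sub>R x) = (r *\<^sub>R x) * (r *\<^sub>R kcnj x)"
    by (simp add: mult_kcnj power2_eq_square algebra_simps)
  with False show ?thesis
    by (metis mult_left_cancel scaleR_eq_0_iff)
qed

text \<open>The midpoint of two points of \<open>C\<close> has norm at least \<open>d\<close>, so
  the parallelogram law bounds their distance by how far their norms exceed \<open>d\<close>. The
  lemma serves twice: for existence and for uniqueness of the minimizer.\<close>

lemma minimizing_sequence_converges:
  fixes v :: "nat \<Rightarrow> 'b::banach"
  assumes parallelogram: "\<And>x y :: 'b. (norm (x + y))\<^sup>2 + (norm (x - y))\<^sup>2 = 2 * (norm x)\<^sup>2 + 2 * (norm y)\<^sup>2"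
    and "convex C" and C: "\<And>x. x \<in> C \<Longrightarrow> d \<le> norm x" and "0 \<le> d"
    and v: "\<And>n. v n \<in> C" and lim: "(\<lambda>n. norm (v n)) \<longlonglongrightarrow> d"
  shows "convergent v"
proof -
  have bound: "(norm (x - y))\<^sup>2 \<le> 2 * ((norm x)\<^sup>2 - d\<^sup>2) + 2 * ((norm y)\<^sup>2 - d\<^sup>2)"
    if "x \<in> C" "y \<in> C" for x y
  proof -
    have "(1/2) *\<^sub>R x + (1/2) *\<^sub>R y \<in> C"
      using that \<open>convex C\<close> by (intro convexD) auto
    from C[OF this] have "2 * d \<le> norm (x + y)"
      by (simp flip: scaleR_add_right)
    then have "(2 * d)\<^sup>2 \<le> (norm (x + y))\<^sup>2"
      using \<open>0 \<le> d\<close> by (intro power_mono) auto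
    then show ?thesis
      using parallelogram[of x y] by (simp add: power2_eq_square)
  qed
  have "Cauchy v"
  proof (rule metric_CauchyI)
    fix e :: real
    assume "0 < e"
    have "(\<lambda>n. (norm (v n))\<^sup>2) \<longlonglongrightarrow> d\<^sup>2"
      using lim by (intro tendsto_intros)
    \<comment> \<open>With this margin each of the two terms in \<open>bound\<close> is below
      \<open>2 * (e\<^sup>2 / 4)\<close>, which adds up to \<open>e\<^sup>2\<close>.\<close>
    then have "\<forall>\<^sub>F n in sequentially. (norm (v n))\<^sup>2 < d\<^sup>2 + e\<^sup>2 / 4"
      using \<open>0 < e\<close> by (intro order_tendstoD) auto
    then obtain N where N: "\<And>n. n \<ge> N \<Longrightarrow> (norm (v n))\<^sup>2 < d\<^sup>2 + e\<^sup>2 / 4"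
      by (auto simp: eventually_sequentially)
    show "\<exists>M. \<forall>m\<ge>M. \<forall>n\<ge>M. dist (v m) (v n) < e"
    proof (intro exI allI impI)
      fix m n
      assume "N \<le> m" "N \<le> n"
      then have "(norm (v m - v n))\<^sup>2 < e\<^sup>2"
        using bound[OF v[of m] v[of n]] N[of m] N[of n] by argo
      then show "dist (v m) (v n) < e"
        using \<open>0 < e\<close> by (simp add: dist_norm power_less_imp_less_base)
    qed
  qed
  then show ?thesis
    by (rule Cauchy_convergent)
qed

text \<open>A norm-preserving self-map of \<open>C\<close> sends a point of minimal norm to a point
  of minimal norm, and there is only one such point.\<close>

lemma isometry_fixed_point:
  fixes T :: "'b::banach \<Rightarrow> 'b"
  assumes parallelogram: "\<And>x y :: 'b. (norm (x + y))\<^sup>2 + (norm (x - y))\<^sup>2 = 2 * (norm x)\<^sup>2 + 2 * (norm y)\<^sup>2"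
    and "convex C" "closed C" "C \<noteq> {}"
    and T: "\<And>x. x \<in> C \<Longrightarrow> T x \<in> C" and norm_T: "\<And>x. x \<in> C \<Longrightarrow> norm (T x) = norm x"
  shows "\<exists>x\<in>C. T x = x"
proof -
  define d where "d = Inf (norm ` C)"
  have bdd: "bdd_below (norm ` C)"
    by (intro bdd_belowI2[where m = 0]) auto
  have d: "d \<le> norm x" if "x \<in> C" for x
    unfolding d_def using bdd that by (intro cInf_lower) auto
  have "0 \<le> d"
    unfolding d_def using \<open>C \<noteq> {}\<close> by (intro cInf_greatest) auto
  have "\<exists>x\<in>C. norm x < d + 1 / Suc n" for n
    using cInf_lessD[of "norm ` C" "d + 1 / Suc n"] \<open>C \<noteq> {}\<close> by (auto simp: d_def)
  then obtain v where v: "v n \<in> C" "norm (v n) < d + 1 / Suc n" for n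
    by metis
  have lim_d: "(\<lambda>n. norm (v n)) \<longlonglongrightarrow> d"
  proof (rule tendsto_sandwich[of "\<lambda>_. d" _ _ "\<lambda>n. d + 1 / Suc n"])
    show "(\<lambda>n. d + 1 / Suc n) \<longlonglongrightarrow> d"
      using tendsto_add[OF tendsto_const LIMSEQ_inverse_real_of_nat, of d] by (simp add: divide_inverse)
  qed (use d v in \<open>auto intro!: always_eventually intro: less_imp_le\<close>)
  obtain x where x: "v \<longlonglongrightarrow> x"
    using minimizing_sequence_converges[OF parallelogram \<open>convex C\<close> d \<open>0 \<le> d\<close> v(1) lim_d]
    by (auto simp: convergent_def)
  have "x \<in> C"
    using \<open>closed C\<close> v(1) x by (metis closed_sequentially)
  have "norm x = d"
    using LIMSEQ_unique[OF tendsto_norm[OF x] lim_d] .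
  \<comment> \<open>Uniqueness of the minimizer: a sequence alternating between two minimizers converges.\<close>
  define w where "w n = (if even n then x else T x)" for n :: nat
  have "convergent w"
  proof (rule minimizing_sequence_converges[OF parallelogram \<open>convex C\<close> d \<open>0 \<le> d\<close>])
    show "w n \<in> C" for n
      using \<open>x \<in> C\<close> T by (simp add: w_def)
    have "norm (w n) = d" for n
      using \<open>x \<in> C\<close> norm_T \<open>norm x = d\<close> by (simp add: w_def)
    then show "(\<lambda>n. norm (w n)) \<longlonglongrightarrow> d"
      by simp
  qed auto
  then obtain l where l: "w \<longlonglongrightarrow> l"
    by (auto simp: convergent_def)
  have "(w \<circ> (\<lambda>n. 2 * n)) \<longlonglongrightarrow> l" "(w \<circ> (\<lambda>n. 2 * n + 1)) \<longlonglongrightarrow> l"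
    by (intro LIMSEQ_subseq_LIMSEQ[OF l]; simp add: strict_mono_def)+
  then have "(\<lambda>_::nat. x) \<longlonglongrightarrow> l" "(\<lambda>_::nat. T x) \<longlonglongrightarrow> l"
    by (simp_all add: w_def o_def)
  then have "T x = x"
    by (metis LIMSEQ_const_iff)
  with \<open>x \<in> C\<close> show ?thesis
    by blast
qed

section \<open>Norm and scalar multiplication in a Hilbert space\<close>

context hilbert_space
begin

lemma subspace_scaleR:
  assumes "subspace S" "x \<in> S"
  shows "r *\<^sub>R x \<in> S"
  using subspace_scale[OF assms, of "of_real r"] by (simp add: smult_of_real)

lemma ip_minus_right: "ip x (- y) = - ip x y"
  using ip_smult_right[of x "of_real (-1)" y] smult_of_real[of "-1" y] by simp

lemma ip_add_left: "ip (x + y) z = ip x z + ip y z"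
  by (metis ip_add_right ip_commute kcnj_add)

lemma ip_minus_left: "ip (- x) y = - ip x y"
  using kcnj_scaleR[of "-1" "ip y x"] by (metis ip_commute ip_minus_right scaleR_minus1_left)

lemma parallelogram:
  fixes x y :: 'a
  shows "(norm (x + y))\<^sup>2 + (norm (x - y))\<^sup>2 = 2 * (norm x)\<^sup>2 + 2 * (norm y)\<^sup>2"
proof -
  \<comment> \<open>The mixed terms cancel. The identity holds in the scalar field and descends to
    the reals because \<open>of_real\<close> is injective.\<close>
  have "ip (x + y) (x + y) + ip (x + - y) (x + - y) = ip x x + ip x x + (ip y y + ip y y)"
    by (simp only: ip_add_left ip_add_right ip_minus_left ip_minus_right minus_minus) simp
  then have "(of_real ((norm (x + y))\<^sup>2 + (norm (x - y))\<^sup>2) :: 'k)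
      = of_real (2 * (norm x)\<^sup>2 + 2 * (norm y)\<^sup>2)"
    by (simp add: ip_self)
  then show ?thesis
    by (rule of_real_eq_iff[THEN iffD1])
qed

text \<open>The locale relates \<open>norm\<close> to general scalars only through
  \<open>ip\<close>; sesquilinearity together with \<open>mult_kcnj\<close> yields the scaling law,
  and with it the continuity of \<open>smult c\<close>.\<close>

lemma norm_smult: "norm (smult c x) = norm c * norm x"
proof -
  have "ip (smult c x) x = kcnj ((norm x)\<^sup>2 *\<^sub>R c)"
    by (subst ip_commute) (simp add: ip_smult_right ip_self scaleR_conv_of_real mult.commute)
  then have "ip (smult c x) (smult c x) = (norm x)\<^sup>2 *\<^sub>R (c * kcnj c)"
    by (simp add: ip_smult_right kcnj_scaleR)
  then have "(of_real ((norm (smult c x))\<^sup>2) :: 'k) = of_real ((norm c * norm x)\<^sup>2)"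
    by (simp add: ip_self mult_kcnj scaleR_conv_of_real power_mult_distrib mult.commute)
  then have "(norm (smult c x))\<^sup>2 = (norm c * norm x)\<^sup>2"
    by (rule of_real_eq_iff[THEN iffD1])
  then show ?thesis
    by (rule power2_eq_imp_eq) auto
qed

lemma tendsto_smult:
  assumes "(f \<longlongrightarrow> l) F"
  shows "((\<lambda>x. smult c (f x)) \<longlongrightarrow> smult c l) F"
proof -
  have "((\<lambda>x. norm c * norm (f x - l)) \<longlongrightarrow> norm c * norm (l - l)) F"
    by (intro tendsto_intros assms)
  then have "((\<lambda>x. norm (smult c (f x) - smult c l)) \<longlongrightarrow> 0) F"
    by (simp add: norm_smult flip: scale_right_diff_distrib)
  then show ?thesis
    by (simp add: LIM_zero_iff tendsto_norm_zero_iff)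
qed

lemma subspace_closure:
  assumes "subspace S"
  shows "subspace (closure S)"
proof (rule subspaceI)
  show "0 \<in> closure S"
    using subspace_0[OF assms] closure_subset by blast
  show "x + y \<in> closure S" if xy: "x \<in> closure S" "y \<in> closure S" for x y
  proof -
    obtain f g where "\<And>n. f n \<in> S" "f \<longlonglongrightarrow> x" "\<And>n. g n \<in> S" "g \<longlonglongrightarrow> y"
      using xy unfolding closure_sequential by blast
    then show ?thesis
      unfolding closure_sequential
      by (intro exI[of _ "\<lambda>n. f n + g n"]) (auto intro: tendsto_add subspace_add[OF assms])
  qed
  show "smult c x \<in> closure S" if "x \<in> closure S" for c x
  proof -
    obtain f where "\<And>n. f n \<in> S" "f \<longlonglongrightarrow> x"
      using \<open>x \<in> closure S\<close> unfolding closure_sequential by metis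
    then show ?thesis
      unfolding closure_sequential
      by (intro exI[of _ "\<lambda>n. smult c (f n)"]) (auto intro: tendsto_smult subspace_scale[OF assms])
  qed
qed

end

section \<open>Linear isometries on subspaces and their extension to closures\<close>

text \<open>One interface for coface maps, the embeddings \<open>\<iota> k\<close> and the partial
  shifts. The domain is required to be a subspace so that sums and differences stay inside
  it.\<close>

locale isometry_on =
  A: hilbert_space smA ipA + B: hilbert_space smB ipB
  for smA :: "'k::rc_field \<Rightarrow> 'a::banach \<Rightarrow> 'a" and ipA :: "'a \<Rightarrow> 'a \<Rightarrow> 'k"
    and smB :: "'k \<Rightarrow> 'b::banach \<Rightarrow> 'b" and ipB :: "'b \<Rightarrow> 'b \<Rightarrow> 'k" +
  fixes S :: "'a set" and T :: "'b set" and f :: "'a \<Rightarrow> 'b"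
  assumes subspace_dom: "A.subspace S"
    and isometry: "linear_isometry_on smA smB S T f"
begin

lemma mem: "x \<in> S \<Longrightarrow> f x \<in> T"
  and add: "x \<in> S \<Longrightarrow> y \<in> S \<Longrightarrow> f (x + y) = f x + f y"
  and smult: "x \<in> S \<Longrightarrow> f (smA c x) = smB c (f x)"
  and norm: "x \<in> S \<Longrightarrow> norm (f x) = norm x"
  using isometry unfolding linear_isometry_on_def by auto

lemma scaleR: "x \<in> S \<Longrightarrow> f (r *\<^sub>R x) = r *\<^sub>R f x"
  using smult[of x "of_real r"] by (simp add: A.smult_of_real B.smult_of_real)

lemma diff: "x \<in> S \<Longrightarrow> y \<in> S \<Longrightarrow> f (x - y) = f x - f y"
  using add[of "x - y" y] A.subspace_diff[OF subspace_dom, of x y] by (simp add: algebra_simps)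

lemma dist: "x \<in> S \<Longrightarrow> y \<in> S \<Longrightarrow> dist (f x) (f y) = dist x y"
  using norm[of "x - y"] A.subspace_diff[OF subspace_dom, of x y] by (simp add: diff dist_norm)

lemma inj: "x \<in> S \<Longrightarrow> y \<in> S \<Longrightarrow> f x = f y \<longleftrightarrow> x = y"
  using dist[of x y] by auto

lemma zero: "f 0 = 0"
  using scaleR[of 0 0] A.subspace_0[OF subspace_dom] by simp

lemma sum: "(\<And>i. i \<in> I \<Longrightarrow> g i \<in> S) \<Longrightarrow> f (\<Sum>i\<in>I. g i) = (\<Sum>i\<in>I. f (g i))"
proof (induction I rule: infinite_finite_induct)
  case (insert i I)
  then show ?case
    by (simp add: add A.subspace_sum[OF subspace_dom])
qed (auto simp: zero)

lemma sum_scaleR: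
  assumes "\<And>i. i \<in> I \<Longrightarrow> g i \<in> S"
  shows "f (\<Sum>i\<in>I. c i *\<^sub>R g i) = (\<Sum>i\<in>I. c i *\<^sub>R f (g i))"
proof -
  have "f (\<Sum>i\<in>I. c i *\<^sub>R g i) = (\<Sum>i\<in>I. f (c i *\<^sub>R g i))"
    using assms by (intro sum A.subspace_scaleR[OF subspace_dom])
  also have "\<dots> = (\<Sum>i\<in>I. c i *\<^sub>R f (g i))"
    using assms by (intro sum.cong) (auto simp: scaleR)
  finally show ?thesis .
qed

lemma continuous: "continuous_on S f"
  unfolding continuous_on_iff by (metis dist)

lemma tendsto: "(\<And>n. u n \<in> S) \<Longrightarrow> x \<in> S \<Longrightarrow> u \<longlonglongrightarrow> x \<Longrightarrow> (\<lambda>n. f (u n)) \<longlonglongrightarrow> f x"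
  using continuous unfolding continuous_on_sequentially by (auto simp: o_def)

text \<open>An isometry is uniformly continuous, hence extends continuously to the closure;
  linearity and norm preservation pass to limits of sequences from \<open>S\<close>.\<close>

lemma extension:
  "\<exists>g. linear_isometry_on smA smB (closure S) (closure T) g \<and> (\<forall>x\<in>S. g x = f x)"
proof -
  have "uniformly_continuous_on S f"
    unfolding uniformly_continuous_on_def by (metis dist)
  then obtain g where g: "uniformly_continuous_on (closure S) g" "\<And>x. x \<in> S \<Longrightarrow> f x = g x"
    by (rule uniformly_continuous_on_extension_on_closure) blast
  \<comment> \<open>The value of \<open>g\<close> can be computed along any approximating sequence,
    so each clause below follows from the same clause for \<open>f\<close> and uniqueness of
    limits.\<close>
  have lim: "(\<lambda>n. f (u n)) \<longlonglongrightarrow> g x" if "\<And>n. u n \<in> S" "u \<longlonglongrightarrow> x" for u x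
  proof -
    have "x \<in> closure S"
      using that unfolding closure_sequential by blast
    moreover have "u n \<in> closure S" for n
      using that(1) closure_subset by blast
    ultimately have "(g \<circ> u) \<longlonglongrightarrow> g x"
      using uniformly_continuous_imp_continuous[OF g(1)] that(2)
      unfolding continuous_on_sequentially by blast
    then show ?thesis
      using that g(2) by (simp add: o_def)
  qed
  have "linear_isometry_on smA smB (closure S) (closure T) g"
    unfolding linear_isometry_on_def
  proof (intro conjI ballI allI image_subsetI)
    fix x
    assume "x \<in> closure S"
    then obtain u where u: "\<And>n. u n \<in> S" "u \<longlonglongrightarrow> x"
      unfolding closure_sequential by blast
    show "g x \<in> closure T"
      using lim[OF u] mem[OF u(1)] unfolding closure_sequential
      by (intro exI[of _ "\<lambda>n. f (u n)"]) simp
    have "(\<lambda>n. norm (u n)) \<longlonglongrightarrow> norm (g x)"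
      using tendsto_norm[OF lim[OF u]] by (simp add: norm[OF u(1)])
    then show "norm (g x) = norm x"
      using LIMSEQ_unique tendsto_norm[OF u(2)] by blast
    show "g (smA c x) = smB c (g x)" for c
    proof -
      have "(\<lambda>n. f (smA c (u n))) \<longlonglongrightarrow> g (smA c x)"
        using u by (intro lim A.tendsto_smult A.subspace_scale[OF subspace_dom]) auto
      moreover have "(\<lambda>n. f (smA c (u n))) \<longlonglongrightarrow> smB c (g x)"
        using B.tendsto_smult[OF lim[OF u]] by (simp add: smult[OF u(1)])
      ultimately show ?thesis
        by (rule LIMSEQ_unique)
    qed
    fix y
    assume "y \<in> closure S"
    then obtain w where w: "\<And>n. w n \<in> S" "w \<longlonglongrightarrow> y"
      unfolding closure_sequential by blast
    have "(\<lambda>n. f (u n + w n)) \<longlonglongrightarrow> g (x + y)"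
      using u w by (intro lim tendsto_add A.subspace_add[OF subspace_dom]) auto
    moreover have "(\<lambda>n. f (u n + w n)) \<longlonglongrightarrow> g x + g y"
      using tendsto_add[OF lim[OF u] lim[OF w]] by (simp add: add[OF u(1) w(1)])
    ultimately show "g (x + y) = g x + g y"
      by (rule LIMSEQ_unique)
  qed
  with g(2) show ?thesis
    by metis
qed

end

section \<open>Cohomology groups and the cochain complex\<close>

text \<open>Meant for \<open>S\<close> the cocycles, once the coboundaries are known to be the same
  set: every coset of \<open>S\<close> by one of its own elements is \<open>S\<close>.\<close>

lemma trivial_group_Mod_self:
  fixes S :: "'a::ab_group_add set"
  assumes "0 \<in> S" "\<And>x y. x \<in> S \<Longrightarrow> y \<in> S \<Longrightarrow> x + y \<in> S" "\<And>x. x \<in> S \<Longrightarrow> - x \<in> S"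
  shows "trivial_group (additive_group S Mod S)"
proof -
  have S: "group (additive_group S)"
    using assms by (intro groupI) (auto simp: additive_group_def add.assoc intro: bexI[of _ "- _"])
  then interpret group "additive_group S" .
  have carrier: "carrier (additive_group S) = S"
    by (simp add: additive_group_def)
  have "group (additive_group S Mod S)"
    using normal.factorgroup_is_group[OF normal_self] by (simp add: carrier)
  moreover have "S #>\<^bsub>additive_group S\<^esub> x = S" if "x \<in> S" for x
    using that coset_join2[OF _ subgroup_self] by (simp add: carrier)
  then have "carrier (additive_group S Mod S) = {S}"
    using \<open>0 \<in> S\<close> by (auto simp: carrier_FactGroup carrier)
  ultimately show ?thesis
    unfolding trivial_group_def by simp
qed

context semi_cosimplicial_hilbert_space
begin

lemma delta: "0 \<le> i \<Longrightarrow> i \<le> n \<Longrightarrow> isometry_on smult ip smult ip (H (n - 1)) (H n) (\<delta> n i)"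
  by (intro isometry_on.intro isometry_on_axioms.intro hilbert_space_axioms H_subspace
        delta_isometry) auto

lemma subspace_cochains: "subspace (cochains H n)"
  using H_subspace by (auto simp: cochains_def subspace_def)

lemma sign_scaleR_mem:
  assumes "0 \<le> i" "i \<le> n" "x \<in> H (n - 1)"
  shows "(-1) ^ m *\<^sub>R \<delta> n i x \<in> H n"
  using assms by (intro subspace_scaleR[OF H_subspace] isometry_on.mem[OF delta]) auto

lemma cobdry_mem: "x \<in> cochains H n \<Longrightarrow> cobdry \<delta> n x \<in> cochains H (n + 1)"
  using sign_scaleR_mem[of _ "n + 1" x]
  by (auto simp: cobdry_def cochains_def intro!: subspace_sum[OF H_subspace] subspace_0[OF H_subspace])

lemma cobdry_add:
  assumes "x \<in> cochains H n" "y \<in> cochains H n"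
  shows "cobdry \<delta> n (x + y) = cobdry \<delta> n x + cobdry \<delta> n y"
  using assms isometry_on.add[OF delta, of _ "n + 1" x y]
  by (auto simp: cobdry_def cochains_def scaleR_add_right sum.distrib)

lemma cobdry_minus:
  assumes "x \<in> cochains H n"
  shows "cobdry \<delta> n (- x) = - cobdry \<delta> n x"
  using assms isometry_on.scaleR[OF delta, of _ "n + 1" x "-1"]
  by (auto simp: cobdry_def cochains_def simp flip: sum_negf)

lemma cobdry_zero: "cobdry \<delta> n 0 = 0"
  using cobdry_add[of 0 n 0] subspace_0[OF subspace_cochains] by simp

lemma trivial_group_cohomology:
  assumes "cocycles H \<delta> k = coboundaries H \<delta> k"
  shows "trivial_group (cohomology_group H \<delta> k)"
  unfolding cohomology_group_def assms[symmetric]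
  using subspace_cochains[of k]
  by (intro trivial_group_Mod_self)
    (auto simp: cocycles_def cobdry_zero cobdry_add cobdry_minus subspace_0 subspace_add subspace_neg)

text \<open>
  Transposing the pair of indices by \<open>(i, j) \<mapsto> (j, i - 1)\<close> for \<open>j < i\<close> exchanges the terms
  of opposite sign.
\<close>

lemma cobdry_cobdry:
  assumes "k \<ge> 0" "y \<in> H (k - 1)"
  shows "cobdry \<delta> k (cobdry \<delta> (k - 1) y) = 0"
proof -
  define t where "t i j = (-1) ^ nat (k + 1 - i) *\<^sub>R (-1) ^ nat (k - j) *\<^sub>R \<delta> (k + 1) i (\<delta> k j y)"
    for i j
  have "cobdry \<delta> k (cobdry \<delta> (k - 1) y) = (\<Sum>i = 0..k + 1. \<Sum>j = 0..k. t i j)"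
  proof -
    have "(-1) ^ nat (k + 1 - i) *\<^sub>R \<delta> (k + 1) i (\<Sum>j = 0..k. (-1) ^ nat (k - j) *\<^sub>R \<delta> k j y)
        = (\<Sum>j = 0..k. t i j)" if i: "i \<in> {0..k + 1}" for i
    proof -
      from i interpret D: isometry_on smult ip smult ip "H k" "H (k + 1)" "\<delta> (k + 1) i"
        using delta[of i "k + 1"] by simp
      have "\<delta> k j y \<in> H k" if "j \<in> {0..k}" for j
        using that assms by (intro isometry_on.mem[OF delta]) auto
      then have "\<delta> (k + 1) i (\<Sum>j = 0..k. (-1) ^ nat (k - j) *\<^sub>R \<delta> k j y)
          = (\<Sum>j = 0..k. (-1) ^ nat (k - j) *\<^sub>R \<delta> (k + 1) i (\<delta> k j y))"
        by (rule D.sum_scaleR)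
      then show ?thesis
        by (simp add: t_def scaleR_sum_right)
    qed
    with assms(1) show ?thesis
      by (simp add: cobdry_def)
  qed
  also have "\<dots> = (\<Sum>p \<in> {0..k + 1} \<times> {0..k}. t (fst p) (snd p))"
    by (simp add: sum.cartesian_product case_prod_unfold)
  also have "\<dots> = (\<Sum>p \<in> {0..k + 1} \<times> {0..k} \<inter> {p. snd p < fst p}. t (fst p) (snd p))
      + (\<Sum>p \<in> {0..k + 1} \<times> {0..k} - {p. snd p < fst p}. t (fst p) (snd p))"
    by (rule sum.Int_Diff) simp
  also have "(\<Sum>p \<in> {0..k + 1} \<times> {0..k} \<inter> {p. snd p < fst p}. t (fst p) (snd p))
      = (\<Sum>p \<in> {0..k + 1} \<times> {0..k} - {p. snd p < fst p}. - t (fst p) (snd p))"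
  proof (rule sum.reindex_bij_witness[where i = "\<lambda>p. (snd p + 1, fst p)" and j = "\<lambda>p. (snd p, fst p - 1)"],
      goal_cases)
    \<comment> \<open>Goal 5 compares the terms; the other goals say that the two index maps are
      mutually inverse between the two halves.\<close>
    case (5 p)
    obtain i j where p: "p = (i, j)" "0 \<le> j" "j < i" "i \<le> k + 1"
      using 5 by (cases p) auto
    have "\<delta> (k + 1) i (\<delta> k j y) = \<delta> (k + 1) j (\<delta> k (i - 1) y)"
      using delta_delta[of j i "k + 1" y] p assms by simp
    \<comment> \<open>From \<open>(i, j)\<close> to \<open>(j, i - 1)\<close> the two exponents
      trade places and one of them grows by 1, which flips the sign.\<close>
    moreover have "nat (k + 1 - j) = Suc (nat (k - j))" "nat (k - (i - 1)) = nat (k + 1 - i)"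
      using p by (auto simp: nat_eq_iff algebra_simps)
    ultimately show ?case
      by (simp add: t_def p mult.commute)
  qed auto
  finally show ?thesis
    by (simp add: sum_negf)
qed

end

section \<open>The tower and the partial shifts on its closure\<close>

context hilbert_space_tower
begin

lemma iota: "k \<ge> -1 \<Longrightarrow> isometry_on smult ip smult' ip' (H k) UNIV (\<iota> k)"
  by (intro isometry_on.intro isometry_on_axioms.intro hilbert_space_axioms target.hilbert_space_axioms
        H_subspace iota_isometry)

text \<open>Top coface maps lift \<open>x\<close> to any higher level without changing the vector it
  represents. They also commute with the coface map of index \<open>n\<close>, so the prospective
  value of the shift is unchanged.\<close>

lemma tower_push:
  assumes "n \<ge> 0" "k \<ge> n - 1" "k \<le> l" "x \<in> H k"
  shows "\<exists>y\<in>H l. \<iota> l y = \<iota> k x \<and> \<iota> (l + 1) (\<delta> (l + 1) n y) = \<iota> (k + 1) (\<delta> (k + 1) n x)"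
  using \<open>k \<le> l\<close>
proof (induction l rule: int_ge_induct)
  case base
  with \<open>x \<in> H k\<close> show ?case
    by blast
next
  case (step l)
  then obtain y where y: "y \<in> H l" "\<iota> l y = \<iota> k x"
      "\<iota> (l + 1) (\<delta> (l + 1) n y) = \<iota> (k + 1) (\<delta> (k + 1) n x)"
    by blast
  have l: "l \<ge> n - 1" "l \<ge> -1"
    using assms step.hyps by auto
  have \<delta>y: "\<delta> (l + 1) (l + 1) y \<in> H (l + 1)" "\<delta> (l + 1) n y \<in> H (l + 1)"
    using y l assms by (auto intro!: isometry_on.mem[OF delta])
  \<comment> \<open>The cosimplicial identity for the indices \<open>n < l + 2\<close>, the larger
    one being the top index.\<close>
  have "\<delta> (l + 2) n (\<delta> (l + 1) (l + 1) y) = \<delta> (l + 2) (l + 2) (\<delta> (l + 1) n y)"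
    using delta_delta[of n "l + 2" "l + 2" y] y l assms by (simp add: algebra_simps)
  then have "\<iota> (l + 2) (\<delta> (l + 2) n (\<delta> (l + 1) (l + 1) y)) = \<iota> (l + 1) (\<delta> (l + 1) n y)"
    using iota_top[of "l + 2" "\<delta> (l + 1) n y"] \<delta>y l by (simp add: algebra_simps)
  moreover have "\<iota> (l + 1) (\<delta> (l + 1) (l + 1) y) = \<iota> l y"
    using iota_top[of "l + 1" y] y l by simp
  ultimately show ?case
    using y \<delta>y by (auto simp: algebra_simps intro!: bexI[of _ "\<delta> (l + 1) (l + 1) y"])
qed

text \<open>Two representatives of one vector become equal when lifted to a common level, since
  \<open>\<iota> m\<close> is injective there.\<close>

lemma shift_well_defined:
  assumes "n \<ge> 0" "k \<ge> n - 1" "l \<ge> n - 1" "x \<in> H k" "y \<in> H l" "\<iota> k x = \<iota> l y"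
  shows "\<iota> (k + 1) (\<delta> (k + 1) n x) = \<iota> (l + 1) (\<delta> (l + 1) n y)"
proof -
  define m where "m = max k l"
  have m: "k \<le> m" "l \<le> m" "m \<ge> -1"
    using assms by (auto simp: m_def)
  obtain x' y' where "x' \<in> H m" "\<iota> m x' = \<iota> k x" "y' \<in> H m" "\<iota> m y' = \<iota> l y"
    and "\<iota> (m + 1) (\<delta> (m + 1) n x') = \<iota> (k + 1) (\<delta> (k + 1) n x)"
    and "\<iota> (m + 1) (\<delta> (m + 1) n y') = \<iota> (l + 1) (\<delta> (l + 1) n y)"
    using tower_push[of n k m x] tower_push[of n l m y] assms m by blast
  with \<open>\<iota> k x = \<iota> l y\<close> isometry_on.inj[OF iota[OF m(3)]] show ?thesis
    by metis
qed

abbreviation "tower \<equiv> \<Union>k\<in>{-1..}. \<iota> k ` H k"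

lemma tower_at:
  assumes "n \<ge> 0" "u \<in> tower"
  obtains k where "k \<ge> n - 1" "\<And>l. l \<ge> k \<Longrightarrow> u \<in> \<iota> l ` H l"
proof -
  obtain k x where k: "k \<ge> -1" "x \<in> H k" "u = \<iota> k x"
    using assms by auto
  show ?thesis
  proof (rule that[of "max k (n - 1)"])
    show "u \<in> \<iota> l ` H l" if "l \<ge> max k (n - 1)" for l
      \<comment> \<open>Coface index 0 is admissible at every level \<open>k \<ge> -1\<close>; only
        the equality of the represented vectors is used.\<close>
      using tower_push[of 0 k l x] k that by (auto intro: rev_image_eqI)
  qed auto
qed

lemma tower_at2:
  assumes "n \<ge> 0" "u \<in> tower" "v \<in> tower"
  obtains k x y where "k \<ge> n - 1" "x \<in> H k" "y \<in> H k" "u = \<iota> k x" "v = \<iota> k y"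
proof -
  obtain k l where "k \<ge> n - 1" "\<And>m. m \<ge> k \<Longrightarrow> u \<in> \<iota> m ` H m"
    "l \<ge> n - 1" "\<And>m. m \<ge> l \<Longrightarrow> v \<in> \<iota> m ` H m"
    using tower_at[OF assms(1,2)] tower_at[OF assms(1,3)] by metis
  then have "max k l \<ge> n - 1" "u \<in> \<iota> (max k l) ` H (max k l)" "v \<in> \<iota> (max k l) ` H (max k l)"
    by auto
  then show ?thesis
    using that by blast
qed

lemma subspace_tower: "target.subspace tower"
proof (rule target.subspaceI)
  show "0 \<in> tower"
    using isometry_on.zero[OF iota[of 0]] subspace_0[OF H_subspace[of 0]]
    by (intro UN_I[of 0] image_eqI[of _ _ 0]) auto
  show "u + v \<in> tower" if uv: "u \<in> tower" "v \<in> tower" for u v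
  proof -
    obtain k x y where k: "k \<ge> -1" "x \<in> H k" "y \<in> H k" "u = \<iota> k x" "v = \<iota> k y"
      by (rule tower_at2[OF order.refl uv]) auto
    then show ?thesis
      using isometry_on.add[OF iota, of k x y] subspace_add[OF H_subspace, of k x y]
      by (intro UN_I[of k] image_eqI[of _ _ "x + y"]) auto
  qed
  show "smult' c u \<in> tower" if u: "u \<in> tower" for c u
  proof -
    obtain k x where k: "k \<ge> -1" "x \<in> H k" "u = \<iota> k x"
      using u by auto
    then show ?thesis
      using isometry_on.smult[OF iota, of k x c] subspace_scale[OF H_subspace, of k x c]
      by (intro UN_I[of k] image_eqI[of _ _ "smult c x"]) auto
  qed
qed

lemma exists_shift_on_tower:
  assumes "n \<ge> 0"
  shows "\<exists>f. linear_isometry_on smult' smult' tower tower f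
      \<and> (\<forall>k\<ge>n - 1. \<forall>x\<in>H k. f (\<iota> k x) = \<iota> (k + 1) (\<delta> (k + 1) n x))"
proof -
  \<comment> \<open>The choice is over all representatives of \<open>u\<close> at levels where the
    coface map of index \<open>n\<close> exists; by \<open>shift_well_defined\<close> they all give
    the same value.\<close>
  define f where "f u = (SOME v. \<exists>k\<ge>n - 1. \<exists>x\<in>H k. u = \<iota> k x \<and> v = \<iota> (k + 1) (\<delta> (k + 1) n x))" for u
  have f: "f (\<iota> k x) = \<iota> (k + 1) (\<delta> (k + 1) n x)" if "k \<ge> n - 1" "x \<in> H k" for k x
    unfolding f_def
  proof (rule some_equality)
    show "v = \<iota> (k + 1) (\<delta> (k + 1) n x)"
      if "\<exists>l\<ge>n - 1. \<exists>y\<in>H l. \<iota> k x = \<iota> l y \<and> v = \<iota> (l + 1) (\<delta> (l + 1) n y)" for v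
      using that \<open>k \<ge> n - 1\<close> \<open>x \<in> H k\<close> shift_well_defined[OF \<open>n \<ge> 0\<close>] by metis
  qed (use that in blast)
  {
    fix u v
    assume uv: "u \<in> tower" "v \<in> tower"
    \<comment> \<open>At a common level every clause of the isometry property reduces to those of
      \<open>\<delta> (k + 1) n\<close>, \<open>\<iota> k\<close> and
      \<open>\<iota> (k + 1)\<close>.\<close>
    obtain k x y where k: "k \<ge> n - 1" and xy: "x \<in> H k" "y \<in> H k" "u = \<iota> k x" "v = \<iota> k y"
      by (rule tower_at2[OF assms uv])
    interpret D: isometry_on smult ip smult ip "H k" "H (k + 1)" "\<delta> (k + 1) n"
      using delta[of n "k + 1"] k assms by simp
    interpret I: isometry_on smult ip smult' ip' "H k" UNIV "\<iota> k"
      using iota[of k] k assms by simp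
    interpret J: isometry_on smult ip smult' ip' "H (k + 1)" UNIV "\<iota> (k + 1)"
      using iota[of "k + 1"] k assms by simp
    have "f u = \<iota> (k + 1) (\<delta> (k + 1) n x)" "f v = \<iota> (k + 1) (\<delta> (k + 1) n y)"
      using k xy f by auto
    moreover have "f (u + v) = \<iota> (k + 1) (\<delta> (k + 1) n (x + y))"
      using f[OF k, of "x + y"] xy I.add subspace_add[OF D.subspace_dom] by auto
    moreover have "f (smult' c u) = \<iota> (k + 1) (\<delta> (k + 1) n (smult c x))" for c
      using f[OF k, of "smult c x"] xy I.smult subspace_scale[OF D.subspace_dom] by auto
    moreover have "f u \<in> tower"
      using k xy f assms D.mem by (intro UN_I[of "k + 1"]) auto
    ultimately have "f u \<in> tower \<and> f (u + v) = f u + f v \<and> (\<forall>c. f (smult' c u) = smult' c (f u))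
        \<and> norm (f u) = norm u"
      using xy by (simp add: D.add D.smult D.norm I.norm J.add J.smult J.norm D.mem)
  }
  then have "linear_isometry_on smult' smult' tower tower f"
    unfolding linear_isometry_on_def by blast
  with f show ?thesis
    by blast
qed

lemma subspace_limit_space: "target.subspace (limit_space H \<iota>)"
  unfolding limit_space_def by (intro target.subspace_closure subspace_tower)

abbreviation "\<alpha> \<equiv> partial_shift H \<delta> smult' \<iota>"

text \<open>The shift on the tower extends to the closure, so the choice defining
  \<open>partial_shift\<close> is made from a nonempty set.\<close>

lemma partial_shift_spec:
  assumes "n \<ge> 0"
  shows "linear_isometry_on smult' smult' (limit_space H \<iota>) (limit_space H \<iota>) (\<alpha> n)
    \<and> (\<forall>k\<ge>n - 1. \<forall>x\<in>H k. \<alpha> n (\<iota> k x) = \<iota> (k + 1) (\<delta> (k + 1) n x))"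
proof -
  obtain f where f: "linear_isometry_on smult' smult' tower tower f"
    "\<And>k x. k \<ge> n - 1 \<Longrightarrow> x \<in> H k \<Longrightarrow> f (\<iota> k x) = \<iota> (k + 1) (\<delta> (k + 1) n x)"
    using exists_shift_on_tower[OF assms] by blast
  interpret F: isometry_on smult' ip' smult' ip' tower tower f
    by (intro isometry_on.intro isometry_on_axioms.intro target.hilbert_space_axioms subspace_tower f)
  obtain g where "linear_isometry_on smult' smult' (limit_space H \<iota>) (limit_space H \<iota>) g"
    and "\<forall>x\<in>tower. g x = f x"
    using F.extension unfolding limit_space_def by blast
  with f(2) assms have "\<exists>\<alpha>. linear_isometry_on smult' smult' (limit_space H \<iota>) (limit_space H \<iota>) \<alpha>
      \<and> (\<forall>k\<ge>n - 1. \<forall>x\<in>H k. \<alpha> (\<iota> k x) = \<iota> (k + 1) (\<delta> (k + 1) n x))"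
    by (intro exI[of _ g]) force
  then show ?thesis
    unfolding partial_shift_def by (rule someI_ex)
qed

lemma shift: "n \<ge> 0 \<Longrightarrow> isometry_on smult' ip' smult' ip' (limit_space H \<iota>) (limit_space H \<iota>) (\<alpha> n)"
  using partial_shift_spec
  by (intro isometry_on.intro isometry_on_axioms.intro target.hilbert_space_axioms subspace_limit_space)
    blast

lemma shift_iota: "n \<ge> 0 \<Longrightarrow> k \<ge> n - 1 \<Longrightarrow> x \<in> H k \<Longrightarrow> \<alpha> n (\<iota> k x) = \<iota> (k + 1) (\<delta> (k + 1) n x)"
  using partial_shift_spec by blast

text \<open>On level \<open>k\<close> the shift of index \<open>k + 1\<close> is the top coface map,
  which the tower treats as an inclusion. This is the half of saturation that always holds.\<close>

lemma shift_iota_fixed: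
  assumes "k \<ge> -1" "x \<in> H k"
  shows "\<alpha> (k + 1) (\<iota> k x) = \<iota> k x"
  using shift_iota[of "k + 1" k x] iota_top[of "k + 1" x] assms by simp

lemma iota_mem: "k \<ge> -1 \<Longrightarrow> x \<in> H k \<Longrightarrow> \<iota> k x \<in> limit_space H \<iota>"
  unfolding limit_space_def using closure_subset by fastforce

text \<open>On the tower this is the cosimplicial identity; both sides are continuous and the tower
  is dense in the limit space.\<close>

lemma shift_shift:
  assumes "0 \<le> i" "i < j" "u \<in> limit_space H \<iota>"
  shows "\<alpha> j (\<alpha> i u) = \<alpha> i (\<alpha> (j - 1) u)"
proof -
  obtain w where w: "\<And>n. w n \<in> tower" "w \<longlonglongrightarrow> u"
    using assms(3) unfolding limit_space_def closure_sequential by blast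
  interpret Ai: isometry_on smult' ip' smult' ip' "limit_space H \<iota>" "limit_space H \<iota>" "\<alpha> i"
    using assms by (intro shift)
  interpret Aj: isometry_on smult' ip' smult' ip' "limit_space H \<iota>" "limit_space H \<iota>" "\<alpha> j"
    using assms by (intro shift) auto
  interpret Ak: isometry_on smult' ip' smult' ip' "limit_space H \<iota>" "limit_space H \<iota>" "\<alpha> (j - 1)"
    using assms by (intro shift) auto
  have mem: "w n \<in> limit_space H \<iota>" for n
    using w(1) closure_subset unfolding limit_space_def by blast
  have "\<alpha> j (\<alpha> i (w n)) = \<alpha> i (\<alpha> (j - 1) (w n))" for n
  proof -
    \<comment> \<open>From this level on, all shifts in the equation are given by coface
      maps.\<close>
    obtain k where k: "k \<ge> j - 1" "w n \<in> \<iota> k ` H k"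
      using tower_at[of j "w n"] w(1) assms by (metis le_less_trans order.refl order_less_imp_le)
    then obtain x where x: "x \<in> H k" "w n = \<iota> k x"
      by blast
    have "\<delta> (k + 1) i x \<in> H (k + 1)" "\<delta> (k + 1) (j - 1) x \<in> H (k + 1)"
      using x k assms by (auto intro!: isometry_on.mem[OF delta])
    then show ?thesis
      using x k assms delta_delta[of i j "k + 2" x] by (simp add: shift_iota algebra_simps)
  qed
  moreover have "(\<lambda>n. \<alpha> j (\<alpha> i (w n))) \<longlonglongrightarrow> \<alpha> j (\<alpha> i u)"
    "(\<lambda>n. \<alpha> i (\<alpha> (j - 1) (w n))) \<longlonglongrightarrow> \<alpha> i (\<alpha> (j - 1) u)"
    using mem w(2) assms(3) by (auto intro!: Ai.tendsto Aj.tendsto Ak.tendsto Ai.mem Ak.mem)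
  ultimately show ?thesis
    by (metis (no_types, lifting) LIMSEQ_unique ext)
qed

section \<open>Saturation and the vanishing of cohomology\<close>

lemma cocycle_is_coboundary:
  assumes "k \<ge> 0" "saturated_at H \<delta> smult' \<iota> (k - 1)" "x \<in> cocycles H \<delta> k"
  shows "x \<in> coboundaries H \<delta> k"
proof -
  let ?L = "limit_space H \<iota>"
  \<comment> \<open>\<open>s\<close> extends the coboundary map of degree \<open>k - 1\<close> from
    \<open>H (k - 1)\<close> to the whole limit space.\<close>
  define s where "s v = (\<Sum>i = 0..k. (-1) ^ nat (k - i) *\<^sub>R \<alpha> i v)" for v
  define C where "C = {v \<in> ?L. s v = \<iota> k x}"
  have x: "x \<in> H k" "(\<Sum>i = 0..k + 1. (-1) ^ nat (k + 1 - i) *\<^sub>R \<delta> (k + 1) i x) = 0"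
    using assms by (auto simp: cocycles_def cochains_def cobdry_def)
  interpret A: isometry_on smult' ip' smult' ip' ?L ?L "\<alpha> k"
    using assms by (intro shift)
  interpret A1: isometry_on smult' ip' smult' ip' ?L ?L "\<alpha> (k + 1)"
    using assms by (intro shift) auto
  interpret I: isometry_on smult ip smult' ip' "H k" UNIV "\<iota> k"
    using iota assms by simp
  interpret J: isometry_on smult ip smult' ip' "H (k + 1)" UNIV "\<iota> (k + 1)"
    using iota assms by simp
  have L_scaleR: "r *\<^sub>R v \<in> ?L" if "v \<in> ?L" for r v
    using that by (rule target.subspace_scaleR[OF subspace_limit_space])
  \<comment> \<open>Applied with \<open>l = k\<close> to the cocycle and with
    \<open>l = k - 1\<close> to its eventual preimage.\<close>
  have s_iota: "s (\<iota> l y) = \<iota> (l + 1) (\<Sum>i = 0..k. (-1) ^ nat (k - i) *\<^sub>R \<delta> (l + 1) i y)"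
    if "y \<in> H l" "l \<ge> k - 1" for l y
  proof -
    interpret I': isometry_on smult ip smult' ip' "H (l + 1)" UNIV "\<iota> (l + 1)"
      using iota[of "l + 1"] assms that by simp
    have "\<delta> (l + 1) i y \<in> H (l + 1)" if "i \<in> {0..k}" for i
      using \<open>y \<in> H l\<close> \<open>l \<ge> k - 1\<close> that by (intro isometry_on.mem[OF delta]) auto
    then have "\<iota> (l + 1) (\<Sum>i = 0..k. (-1) ^ nat (k - i) *\<^sub>R \<delta> (l + 1) i y)
        = (\<Sum>i = 0..k. (-1) ^ nat (k - i) *\<^sub>R \<iota> (l + 1) (\<delta> (l + 1) i y))"
      by (rule I'.sum_scaleR)
    with that show ?thesis
      by (simp add: s_def shift_iota)
  qed
  have "\<iota> k x \<in> C"
  proof -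
    \<comment> \<open>The top term of the cocycle equation has sign \<open>+1\<close>. In the others
      the exponent exceeds that in \<open>s\<close> by 1, so solving for the top term gives exactly
      the signs of \<open>s\<close>.\<close>
    have "{0..k + 1} = insert (k + 1) {0..k}"
      using assms by auto
    moreover have "nat (k + 1 - i) = Suc (nat (k - i))" if "i \<in> {0..k}" for i
      using that by auto
    ultimately have "\<delta> (k + 1) (k + 1) x = (\<Sum>i = 0..k. (-1) ^ nat (k - i) *\<^sub>R \<delta> (k + 1) i x)"
      using x(2) by (simp add: sum_negf)
    then have "s (\<iota> k x) = \<iota> k x"
      using s_iota[OF x(1)] iota_top[of "k + 1" x] x(1) assms by simp
    then show ?thesis
      using iota_mem x(1) assms by (simp add: C_def)
  qed
  have C_convex: "convex C"
  proof (rule convexI)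
    fix v w :: 'b and p q :: real
    assume vw: "v \<in> C" "w \<in> C" and "p + q = 1"
    then have L: "v \<in> ?L" "w \<in> ?L" "s v = \<iota> k x" "s w = \<iota> k x"
      by (auto simp: C_def)
    have "s (p *\<^sub>R v + q *\<^sub>R w) = p *\<^sub>R s v + q *\<^sub>R s w"
    proof -
      have "\<alpha> i (p *\<^sub>R v + q *\<^sub>R w) = p *\<^sub>R \<alpha> i v + q *\<^sub>R \<alpha> i w" if "i \<in> {0..k}" for i
      proof -
        interpret Ai: isometry_on smult' ip' smult' ip' ?L ?L "\<alpha> i"
          using that by (intro shift) auto
        show ?thesis
          using L by (simp add: Ai.add Ai.scaleR L_scaleR)
      qed
      then show ?thesis
        by (simp add: s_def scaleR_add_right sum.distrib scaleR_sum_right mult.commute)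
    qed
    \<comment> \<open>Both points have the same image under \<open>s\<close>, and the weights add up
      to 1.\<close>
    also have "\<dots> = (p + q) *\<^sub>R \<iota> k x"
      by (simp add: L scaleR_add_left)
    finally show "p *\<^sub>R v + q *\<^sub>R w \<in> C"
      using L \<open>p + q = 1\<close> target.subspace_add[OF subspace_limit_space] by (simp add: C_def L_scaleR)
  qed
  have C_closed: "closed C"
  proof -
    have "continuous_on ?L s"
      unfolding s_def by (intro continuous_intros isometry_on.continuous[OF shift]) auto
    then have "closed (?L \<inter> s -` {\<iota> k x})"
      by (intro continuous_closed_preimage) (auto simp: limit_space_def)
    then show ?thesis
      by (simp add: C_def vimage_def Int_def)
  qed
  have C_invariant: "\<alpha> k v \<in> C" if "v \<in> C" for v
  proof -
    have v: "v \<in> ?L" "s v = \<iota> k x"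
      using that by (auto simp: C_def)
    have mem: "\<alpha> i v \<in> ?L" if "i \<in> {0..k}" for i
      using that v(1) by (intro isometry_on.mem[OF shift]) auto
    \<comment> \<open>As \<open>s v = \<iota> k x\<close> is fixed by
      \<open>\<alpha> (k + 1)\<close>, the left side is again \<open>\<iota> k x\<close>; commuting
      the shifts turns the right side into \<open>s (\<alpha> k v)\<close>.\<close>
    have "\<alpha> (k + 1) (s v) = (\<Sum>i = 0..k. (-1) ^ nat (k - i) *\<^sub>R \<alpha> (k + 1) (\<alpha> i v))"
      unfolding s_def using mem by (rule A1.sum_scaleR)
    also have "\<dots> = s (\<alpha> k v)"
      unfolding s_def using shift_shift[of _ "k + 1" v] v(1) by (intro sum.cong) auto
    finally show ?thesis
      using v A.mem shift_iota_fixed[OF _ x(1)] assms by (simp add: C_def)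
  qed
  have "\<exists>v\<in>C. \<alpha> k v = v"
  proof (rule isometry_fixed_point[OF target.parallelogram C_convex C_closed _ C_invariant])
    show "C \<noteq> {}"
      using \<open>\<iota> k x \<in> C\<close> by blast
    show "norm (\<alpha> k v) = norm v" if "v \<in> C" for v
      using that A.norm by (simp add: C_def)
  qed
  then obtain v where v: "v \<in> C" "\<alpha> k v = v"
    by blast
  \<comment> \<open>Saturation at level \<open>k - 1\<close> concerns the shift of index
    \<open>(k - 1) + 1 = k\<close>, the one fixing \<open>v\<close>.\<close>
  then have "v \<in> \<iota> (k - 1) ` H (k - 1)"
    using assms(2) by (simp add: saturated_at_def C_def)
  then obtain y where y: "y \<in> H (k - 1)" "v = \<iota> (k - 1) y"
    by blast
  \<comment> \<open>At level \<open>k - 1\<close> the indices \<open>0..k\<close> are those of all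
    coface maps, so \<open>s\<close> is the full coboundary.\<close>
  have "\<iota> k (cobdry \<delta> (k - 1) y) = s v"
    using s_iota[OF y(1)] y(2) assms by (simp add: cobdry_def)
  then have "\<iota> k (cobdry \<delta> (k - 1) y) = \<iota> k x"
    using v(1) by (simp add: C_def)
  moreover have "cobdry \<delta> (k - 1) y \<in> H k"
    using cobdry_mem[of y "k - 1"] y(1) assms by (simp add: cochains_def)
  ultimately have "cobdry \<delta> (k - 1) y = x"
    using I.inj x(1) by simp
  then show ?thesis
    using y(1) assms by (auto simp: coboundaries_def cochains_def)
qed

lemma cocycles_eq_coboundaries:
  assumes "k \<ge> 0" "saturated_at H \<delta> smult' \<iota> (k - 1)"
  shows "cocycles H \<delta> k = coboundaries H \<delta> k"
proof
  show "cocycles H \<delta> k \<subseteq> coboundaries H \<delta> k"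
    using cocycle_is_coboundary[OF assms] by blast
  show "coboundaries H \<delta> k \<subseteq> cocycles H \<delta> k"
    using assms(1) cobdry_cobdry cobdry_mem[of _ "k - 1"]
    by (auto simp: coboundaries_def cocycles_def cochains_def)
qed

text \<open>The degree below the range of the saturation argument: here the coboundary map is the
  single isometry \<open>\<delta> 0 0\<close>, hence injective, and the zero space of degree -2 has
  only 0 as image.\<close>

lemma cocycles_minus_one: "cocycles H \<delta> (-1) = coboundaries H \<delta> (-1)"
proof -
  interpret D: isometry_on smult ip smult ip "H (-1)" "H 0" "\<delta> 0 0"
    using delta[of 0 0] by simp
  have "x = 0" if "x \<in> H (-1)" "\<delta> 0 0 x = 0" for x
    using D.norm[OF that(1)] that(2) by simp
  then show ?thesis
    using subspace_0[OF D.subspace_dom] D.zero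
    by (auto simp: cocycles_def coboundaries_def cochains_def cobdry_def)
qed

end

theorem corollary3p5:
  fixes smult :: "'k::rc_field \<Rightarrow> 'a::banach \<Rightarrow> 'a" and ip :: "'a \<Rightarrow> 'a \<Rightarrow> 'k"
    and H :: "int \<Rightarrow> 'a set" and \<delta> :: "int \<Rightarrow> int \<Rightarrow> 'a \<Rightarrow> 'a"
    and smult' :: "'k \<Rightarrow> 'b::banach \<Rightarrow> 'b" and ip' :: "'b \<Rightarrow> 'b \<Rightarrow> 'k"
    and \<iota> :: "int \<Rightarrow> 'a \<Rightarrow> 'b"
  assumes "hilbert_space_tower smult ip H \<delta> smult' ip' \<iota>"
  shows "(\<forall>k\<ge>0. saturated_at H \<delta> smult' \<iota> (k - 1) \<longrightarrow>
            trivial_group (cohomology_group H \<delta> k) \<and> cocycles H \<delta> k = coboundaries H \<delta> k)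
       \<and> (saturated H \<delta> smult' \<iota> \<longrightarrow>
            (\<forall>k\<ge>-1. trivial_group (cohomology_group H \<delta> k) \<and>
                     cocycles H \<delta> k = coboundaries H \<delta> k))"
proof -
  interpret hilbert_space_tower smult ip H \<delta> smult' ip' \<iota>
    by (fact assms)
  \<comment> \<open>For \<open>k \<ge> 0\<close> the level \<open>k - 1\<close> is at least -1, so
    \<open>saturated\<close> covers it.\<close>
  have "cocycles H \<delta> k = coboundaries H \<delta> k" if "saturated H \<delta> smult' \<iota>" "k \<ge> -1" for k
    using that cocycles_minus_one cocycles_eq_coboundaries[of k]
    by (cases "k = -1") (auto simp: saturated_def)
  then show ?thesis
    using cocycles_eq_coboundaries trivial_group_cohomology by blast
qed

end
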